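(* Let $X_t$ be a BN random process, with $X_t\sim\text{BN}(\mu_t,\sigma_t,\alpha)$, whose pairs $(X_t,X_s)$, $t\ne s$, have the bivariate BN distribution with parameters $(\mu_t,\mu_s,\sigma_t,\sigma_s,\alpha)$ and $\rho\in(-1,1)$. Suppose that $\mu_t=\mu$ is independent of time and $\rho=\alpha=0$. Then $X_t$ is variance ergodic, i.e. $$\lim_{T\to\infty}\mathrm{Var}\left[\frac{1}{2T}\int_{-T}^{T}(X_t-\mu)^2\,\mathrm{d}t\right]=0,$$ whenever $$\lim_{T\to\infty}\frac{1}{4T^2}\int_{-T}^{T}\int_{-T}^{T}\mathrm{Cov}(X_t^2,X_{t'}^2)\,\mathrm{d}t'\,\mathrm{d}t=\lim_{T\to\infty}\frac{1}{4T^2}\int_{-T}^{T}\int_{-T}^{T}\mathrm{Cov}(X_t^2,X_{t'})\,\mathrm{d}t'\,\mathrm{d}t=0.$$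
   Context: For $\mu\in\mathbb{R}$, $\sigma>0$, $\alpha\in\mathbb{R}$, BN$(\mu,\sigma,\alpha)$ is the distribution on $\mathbb{R}$ with PDF $$f(x;\mu,\sigma,\alpha)=\frac{1}{\sqrt{2\pi\sigma^2}}\exp\left[-\frac12\left(\frac{x-\mu}{\sigma}\right)^2-\frac{\alpha^2}{2}\right]\cosh\left[\alpha\left(\frac{x-\mu}{\sigma}\right)\right].$$ A process $X_t$ ($t\in\mathbb{R}$) is a BN random process if $X_t\sim\text{BN}(\mu_t,\sigma_t,\alpha)$ for every $t$, with $\mu_t\in\mathbb{R}$, $\sigma_t>0$, $\alpha\in\mathbb{R}$. The bivariate BN distribution with parameters $(\mu_1,\mu_2,\sigma_1,\sigma_2,\alpha)$ and $\rho\in(-1,1)$ has PDF on $\mathbb{R}^2$ $$\frac{\exp[\alpha^2(\rho^2-2)/2]}{\sigma_1\sigma_2}\,\phi\left(\frac{x_1-\mu_1}{\sigma_1},\frac{x_2-\mu_2}{\sigma_2};\rho\right)\cosh\left[\alpha\left(\frac{x_1-\mu_1}{\sigma_1}\right)+\alpha(1-\rho)\left(\frac{x_2-\mu_2}{\sigma_2}\right)\right],$$ where $\phi(z_1,z_2;\rho)=\frac{1}{2\pi\sqrt{1-\rho^2}}\exp\left[-\frac{1}{2(1-\rho^2)}(z_1^2-2\rho z_1z_2+z_2^2)\right]$. In particular, for $\rho=\alpha=0$ this is the law of two independent normal random variables. The process is understood to be such that the integrals above make sense. *)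

theory Defs
  imports "HOL-Probability.Probability"
begin

definition BN_density :: "real \<Rightarrow> real \<Rightarrow> real \<Rightarrow> real \<Rightarrow> real" where
  "BN_density \<mu> \<sigma> \<alpha> x =
     1 / sqrt (2 * pi * \<sigma>\<^sup>2) * exp (- (1 / 2) * ((x - \<mu>) / \<sigma>)\<^sup>2 - \<alpha>\<^sup>2 / 2)
       * cosh (\<alpha> * ((x - \<mu>) / \<sigma>))"

definition std_binormal_density :: "real \<Rightarrow> real \<Rightarrow> real \<Rightarrow> real" where
  "std_binormal_density \<rho> z1 z2 =
     1 / (2 * pi * sqrt (1 - \<rho>\<^sup>2))
       * exp (- (1 / (2 * (1 - \<rho>\<^sup>2))) * (z1\<^sup>2 - 2 * \<rho> * z1 * z2 + z2\<^sup>2))"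

definition biv_BN_density ::
  "real \<Rightarrow> real \<Rightarrow> real \<Rightarrow> real \<Rightarrow> real \<Rightarrow> real \<Rightarrow> real \<times> real \<Rightarrow> real" where
  "biv_BN_density \<mu>1 \<mu>2 \<sigma>1 \<sigma>2 \<alpha> \<rho> = (\<lambda>(x1, x2).
     exp (\<alpha>\<^sup>2 * (\<rho>\<^sup>2 - 2) / 2) / (\<sigma>1 * \<sigma>2)
       * std_binormal_density \<rho> ((x1 - \<mu>1) / \<sigma>1) ((x2 - \<mu>2) / \<sigma>2)
       * cosh (\<alpha> * ((x1 - \<mu>1) / \<sigma>1) + \<alpha> * (1 - \<rho>) * ((x2 - \<mu>2) / \<sigma>2)))"

definition BN_process ::
  "'a measure \<Rightarrow> (real \<Rightarrow> 'a \<Rightarrow> real) \<Rightarrow> (real \<Rightarrow> real) \<Rightarrow> (real \<Rightarrow> real) \<Rightarrow> real \<Rightarrow> bool" where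
  "BN_process M X \<mu> \<sigma> \<alpha> \<longleftrightarrow>
     (\<forall>t. \<sigma> t > 0 \<and> distributed M lborel (X t) (\<lambda>x. ennreal (BN_density (\<mu> t) (\<sigma> t) \<alpha> x)))"

definition biv_BN_pairs ::
  "'a measure \<Rightarrow> (real \<Rightarrow> 'a \<Rightarrow> real) \<Rightarrow> (real \<Rightarrow> real) \<Rightarrow> (real \<Rightarrow> real) \<Rightarrow> real \<Rightarrow> real \<Rightarrow> bool" where
  "biv_BN_pairs M X \<mu> \<sigma> \<alpha> \<rho> \<longleftrightarrow>
     (\<forall>t s. t \<noteq> s \<longrightarrow>
        distributed M (lborel \<Otimes>\<^sub>M lborel) (\<lambda>\<omega>. (X t \<omega>, X s \<omega>))
          (\<lambda>z. ennreal (biv_BN_density (\<mu> t) (\<mu> s) (\<sigma> t) (\<sigma> s) \<alpha> \<rho> z)))"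

definition covariance :: "'a measure \<Rightarrow> ('a \<Rightarrow> real) \<Rightarrow> ('a \<Rightarrow> real) \<Rightarrow> real" where
  "covariance M U V =
     prob_space.expectation M
       (\<lambda>\<omega>. (U \<omega> - prob_space.expectation M U) * (V \<omega> - prob_space.expectation M V))"

definition square_integrable_rv :: "'a measure \<Rightarrow> ('a \<Rightarrow> real) \<Rightarrow> bool" where
  "square_integrable_rv M A \<longleftrightarrow> A \<in> borel_measurable M \<and> integrable M (\<lambda>\<omega>. (A \<omega>)\<^sup>2)"

text \<open>
  The time integral of a process \<open>Y\<close> over \<open>{a..b}\<close> is a random variable \<open>A\<close>, determined up to
  null sets. Two standard senses are provided. In the first, \<open>A\<close> is the Lebesgue integral of
  the sample paths of a jointly measurable process; mere measurability of each path and of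
  \<open>A\<close> would not suffice for any relation between \<open>A\<close> and the covariances of \<open>Y\<close>.
  In the second, \<open>A\<close> is the limit in mean square of the Riemann sums as the mesh tends to
  zero. The second sense is indispensable for families of pairwise independent, nondegenerate
  variables: these are never jointly measurable in \<open>(\<omega>, t)\<close>, yet they do have mean-square
  integrals, for instance when their means are continuous and their variances locally bounded.
\<close>

definition has_path_integral ::
  "'a measure \<Rightarrow> (real \<Rightarrow> 'a \<Rightarrow> real) \<Rightarrow> real \<Rightarrow> real \<Rightarrow> ('a \<Rightarrow> real) \<Rightarrow> bool" where
  "has_path_integral M Y a b A \<longleftrightarrow>
     square_integrable_rv M A \<and>
     (\<lambda>(\<omega>, t). Y t \<omega>) \<in> borel_measurable (M \<Otimes>\<^sub>M restrict_space lborel {a..b}) \<and>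
     (AE \<omega> in M. set_integrable lborel {a..b} (\<lambda>t. Y t \<omega>) \<and>
                 A \<omega> = (LBINT t:{a..b}. Y t \<omega>))"

definition has_ms_integral ::
  "'a measure \<Rightarrow> (real \<Rightarrow> 'a \<Rightarrow> real) \<Rightarrow> real \<Rightarrow> real \<Rightarrow> ('a \<Rightarrow> real) \<Rightarrow> bool" where
  "has_ms_integral M Y a b A \<longleftrightarrow>
     square_integrable_rv M A \<and>
     (\<forall>t\<in>{a..b}. square_integrable_rv M (Y t)) \<and>
     (\<forall>e>0. \<exists>d>0. \<forall>p. p tagged_division_of {a..b} \<and> (\<lambda>x. ball x d) fine p \<longrightarrow>
        prob_space.expectation M
          (\<lambda>\<omega>. (A \<omega> - (\<Sum>(x, K)\<in>p. measure lborel K * Y x \<omega>))\<^sup>2) < e)"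

end

theory Submission
  imports Defs
begin

text \<open>
  For \<open>\<rho> = \<alpha> = 0\<close> the bivariate density is the product of the marginal ones, so the \<open>X\<^sub>t\<close> are
  pairwise independent, and so are the nonnegative variables \<open>Y\<^sub>t = (X\<^sub>t - m)\<^sup>2\<close>. Then every time
  integral \<open>A\<close> of \<open>Y\<close> over a bounded interval has variance \<open>0\<close>. For path integrals, Tonelli gives
  \<open>E A\<^sup>2 = \<integral>\<integral> E (Y\<^sub>t Y\<^sub>s) dt ds = (E A)\<^sup>2\<close>, as the diagonal is a null set. For mean-square integrals,
  \<open>A\<close> is close to a Riemann sum over \<open>n\<close> intervals with distinct tags, whose variance is at most
  \<open>(b - a)\<^sup>2 / n\<close> times a bound for the second moments of the \<open>Y\<^sub>t\<close>. Such a bound exists because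
  nonnegativity dominates each single term by a whole Riemann sum.
\<close>

section \<open>Product formula for nonnegative functions, and path integrals\<close>

text \<open>The joint law is the product of the marginal laws, so Tonelli splits the integral. In
  \<open>ennreal\<close> this asks for no integrability of the factors, which a path integral does
  not supply for a single \<open>Y t\<close>.\<close>

lemma (in prob_space) indep_var_nn_integral:
  assumes indep: "indep_var S X T Y"
    and [measurable]: "f \<in> borel_measurable S" "g \<in> borel_measurable T"
  shows "(\<integral>\<^sup>+\<omega>. f (X \<omega>) * g (Y \<omega>) \<partial>M) = (\<integral>\<^sup>+\<omega>. f (X \<omega>) \<partial>M) * (\<integral>\<^sup>+\<omega>. g (Y \<omega>) \<partial>M)"
proof -
  have [measurable]: "random_variable S X" "random_variable T Y"
    and eq: "distr M S X \<Otimes>\<^sub>M distr M T Y = distr M (S \<Otimes>\<^sub>M T) (\<lambda>\<omega>. (X \<omega>, Y \<omega>))"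
    using indep by (auto simp: indep_var_distribution_eq)
  interpret Y: prob_space "distr M T Y"
    by (rule prob_space_distr) simp
  have "(\<integral>\<^sup>+\<omega>. f (X \<omega>) * g (Y \<omega>) \<partial>M)
      = (\<integral>\<^sup>+z. f (fst z) * g (snd z) \<partial>distr M (S \<Otimes>\<^sub>M T) (\<lambda>\<omega>. (X \<omega>, Y \<omega>)))"
    by (subst nn_integral_distr) auto
  also have "\<dots> = (\<integral>\<^sup>+x. \<integral>\<^sup>+y. f x * g y \<partial>distr M T Y \<partial>distr M S X)"
    unfolding eq[symmetric] by (subst Y.nn_integral_fst[symmetric]) auto
  also have "\<dots> = (\<integral>\<^sup>+x. f x \<partial>distr M S X) * (\<integral>\<^sup>+y. g y \<partial>distr M T Y)"
    by (simp add: nn_integral_cmult nn_integral_multc)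
  also have "\<dots> = (\<integral>\<^sup>+\<omega>. f (X \<omega>) \<partial>M) * (\<integral>\<^sup>+\<omega>. g (Y \<omega>) \<partial>M)"
    by (simp add: nn_integral_distr)
  finally show ?thesis .
qed

lemma (in prob_space) variance_path_integral_eq_0:
  fixes Y :: "real \<Rightarrow> 'a \<Rightarrow> real"
  assumes nonneg: "\<And>t \<omega>. 0 \<le> Y t \<omega>"
    and indep: "\<And>t s. t \<noteq> s \<Longrightarrow> indep_var borel (Y t) borel (Y s)"
    and path: "has_path_integral M Y a b A"
  shows "variance A = 0"
proof -
  define L where "L = restrict_space lborel {a..b}"
  define g where "g \<omega> t = ennreal (Y t \<omega>)" for \<omega> t
  define N where "N t = (\<integral>\<^sup>+\<omega>. g \<omega> t \<partial>M)" for t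
  have A [measurable]: "A \<in> borel_measurable M" and A2: "integrable M (\<lambda>\<omega>. (A \<omega>)\<^sup>2)"
    using path by (auto simp: has_path_integral_def square_integrable_rv_def)
  have A1: "integrable M A"
    by (rule square_integrable_imp_integrable[OF A A2])
  interpret L: finite_measure L
    by (rule finite_measureI) (simp add: L_def emeasure_restrict_space space_restrict_space emeasure_lborel_Icc_eq)
  interpret P: pair_sigma_finite M L ..
  have "(\<lambda>(\<omega>, t). Y t \<omega>) \<in> borel_measurable (M \<Otimes>\<^sub>M L)"
    using path by (simp add: has_path_integral_def L_def)
  then have g [measurable]: "case_prod g \<in> borel_measurable (M \<Otimes>\<^sub>M L)"
    by (simp add: g_def[abs_def] case_prod_beta')
  have N [measurable]: "N \<in> borel_measurable L"
    unfolding N_def by measurable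
  \<comment> \<open>\<open>A\<close> equals the integral of the path only almost everywhere, so even
    its sign is known only up to a null set.\<close>
  have A_eq: "AE \<omega> in M. 0 \<le> A \<omega> \<and> ennreal (A \<omega>) = (\<integral>\<^sup>+t. g \<omega> t \<partial>L)"
  proof -
    have "AE \<omega> in M. set_integrable lborel {a..b} (\<lambda>t. Y t \<omega>) \<and> A \<omega> = (LBINT t:{a..b}. Y t \<omega>)"
      using path by (simp add: has_path_integral_def)
    then show ?thesis
    proof (rule AE_mp, intro AE_I2 impI)
      fix \<omega>
      assume *: "set_integrable lborel {a..b} (\<lambda>t. Y t \<omega>) \<and> A \<omega> = (LBINT t:{a..b}. Y t \<omega>)"
      then have "integrable L (\<lambda>t. Y t \<omega>)"
        by (simp add: L_def integrable_restrict_space set_integrable_def)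
      moreover have "A \<omega> = (\<integral>t. Y t \<omega> \<partial>L)"
        using * by (simp add: L_def integral_restrict_space set_lebesgue_integral_def)
      ultimately show "0 \<le> A \<omega> \<and> ennreal (A \<omega>) = (\<integral>\<^sup>+t. g \<omega> t \<partial>L)"
        by (simp add: g_def nn_integral_eq_integral nonneg)
    qed
  qed
  have pair: "(\<integral>\<^sup>+\<omega>. g \<omega> t * g \<omega> s \<partial>M) = N t * N s" if "t \<noteq> s" for t s
    unfolding g_def N_def by (rule indep_var_nn_integral[OF indep[OF that]]) auto
  have E1: "ennreal (expectation A) = (\<integral>\<^sup>+t. N t \<partial>L)"
  proof -
    have "ennreal (expectation A) = (\<integral>\<^sup>+\<omega>. ennreal (A \<omega>) \<partial>M)"
      using A_eq by (intro nn_integral_eq_integral[symmetric] A1) auto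
    also have "\<dots> = (\<integral>\<^sup>+\<omega>. \<integral>\<^sup>+t. g \<omega> t \<partial>L \<partial>M)"
      using A_eq by (intro nn_integral_cong_AE) auto
    also have "\<dots> = (\<integral>\<^sup>+t. N t \<partial>L)"
      unfolding N_def by (rule P.Fubini'[symmetric]) simp
    finally show ?thesis .
  qed
  have E2: "ennreal (expectation (\<lambda>\<omega>. (A \<omega>)\<^sup>2)) = (\<integral>\<^sup>+t. N t \<partial>L) * (\<integral>\<^sup>+t. N t \<partial>L)"
  proof -
    have "ennreal (expectation (\<lambda>\<omega>. (A \<omega>)\<^sup>2)) = (\<integral>\<^sup>+\<omega>. ennreal ((A \<omega>)\<^sup>2) \<partial>M)"
      by (intro nn_integral_eq_integral[symmetric] A2) auto
    also have "\<dots> = (\<integral>\<^sup>+\<omega>. (\<integral>\<^sup>+t. g \<omega> t \<partial>L) * (\<integral>\<^sup>+s. g \<omega> s \<partial>L) \<partial>M)"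
      using A_eq by (intro nn_integral_cong_AE) (auto simp: power2_eq_square ennreal_mult)
    \<comment> \<open>The square of the time integral becomes a double integral; the next two steps
      carry the expectation inside, past \<open>t\<close> and then past \<open>s\<close>.\<close>
    also have "\<dots> = (\<integral>\<^sup>+\<omega>. \<integral>\<^sup>+t. \<integral>\<^sup>+s. g \<omega> t * g \<omega> s \<partial>L \<partial>L \<partial>M)"
      by (intro nn_integral_cong) (simp add: nn_integral_cmult nn_integral_multc)
    also have "\<dots> = (\<integral>\<^sup>+t. \<integral>\<^sup>+\<omega>. \<integral>\<^sup>+s. g \<omega> t * g \<omega> s \<partial>L \<partial>M \<partial>L)"
      by (rule P.Fubini'[symmetric]) measurable
    also have "\<dots> = (\<integral>\<^sup>+t. \<integral>\<^sup>+s. \<integral>\<^sup>+\<omega>. g \<omega> t * g \<omega> s \<partial>M \<partial>L \<partial>L)"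
      by (intro nn_integral_cong P.Fubini'[symmetric]) measurable
    also have "\<dots> = (\<integral>\<^sup>+t. \<integral>\<^sup>+s. N t * N s \<partial>L \<partial>L)"
    proof (rule nn_integral_cong, rule nn_integral_cong_AE)
      fix t
      have "AE s in L. s \<noteq> t"
        using AE_lborel_singleton[of t] unfolding L_def
        by (subst AE_restrict_space_iff) auto
      then show "AE s in L. (\<integral>\<^sup>+\<omega>. g \<omega> t * g \<omega> s \<partial>M) = N t * N s"
        by eventually_elim (simp add: pair)
    qed
    also have "\<dots> = (\<integral>\<^sup>+t. N t \<partial>L) * (\<integral>\<^sup>+t. N t \<partial>L)"
      by (simp add: nn_integral_cmult nn_integral_multc)
    finally show ?thesis .
  qed
  \<comment> \<open>By \<open>E1\<close> the integral of \<open>N\<close> is a real number, so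
    \<open>E2\<close> relates finite quantities and can be read in the reals.\<close>
  have "0 \<le> expectation A"
    using A_eq by (intro integral_nonneg_AE) auto
  then have "ennreal (expectation (\<lambda>\<omega>. (A \<omega>)\<^sup>2)) = ennreal ((expectation A)\<^sup>2)"
    unfolding E2 E1[symmetric] by (simp add: ennreal_mult power2_eq_square)
  then have "expectation (\<lambda>\<omega>. (A \<omega>)\<^sup>2) = (expectation A)\<^sup>2"
    by (simp add: ennreal_inj)
  then show ?thesis
    by (simp add: variance_eq[OF A1 A2])
qed

section \<open>Elementary facts on variances\<close>

text \<open>The mean minimises the mean-square deviation: the two sides differ by the square of
  \<open>expectation A - c\<close>. It serves with \<open>c = 0\<close> for one term of a Riemann
  sum, and with \<open>c\<close> the mean of the whole sum.\<close>

lemma (in prob_space) variance_le_second_moment_about: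
  fixes A :: "'a \<Rightarrow> real"
  assumes A1: "integrable M A" and A2: "integrable M (\<lambda>\<omega>. (A \<omega>)\<^sup>2)"
  shows "variance A \<le> expectation (\<lambda>\<omega>. (A \<omega> - c)\<^sup>2)"
proof -
  have "expectation (\<lambda>\<omega>. (A \<omega> - c)\<^sup>2) = expectation (\<lambda>\<omega>. (A \<omega>)\<^sup>2) - 2 * expectation A * c + c\<^sup>2"
    using A1 A2 by (simp add: power2_diff prob_space mult.assoc)
  moreover have "0 \<le> (expectation A - c)\<^sup>2"
    by simp
  ultimately show ?thesis
    unfolding variance_eq[OF A1 A2] by (simp add: power2_diff)
qed

text \<open>After centring, the square of the sum expands into products of two variables. The
  off-diagonal ones have expectation 0 by independence of the pair, and the diagonal ones are the
  variances.\<close>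

lemma (in prob_space) variance_sum_pairwise_indep:
  fixes Y :: "'i \<Rightarrow> 'a \<Rightarrow> real"
  assumes fin: "finite J"
    and indep: "\<And>i j. i \<in> J \<Longrightarrow> j \<in> J \<Longrightarrow> i \<noteq> j \<Longrightarrow> indep_var borel (Y i) borel (Y j)"
    and Y1: "\<And>i. i \<in> J \<Longrightarrow> integrable M (Y i)"
    and Y2: "\<And>i. i \<in> J \<Longrightarrow> integrable M (\<lambda>\<omega>. (Y i \<omega>)\<^sup>2)"
  shows "variance (\<lambda>\<omega>. \<Sum>i\<in>J. Y i \<omega>) = (\<Sum>i\<in>J. variance (Y i))"
proof -
  define Z where "Z i \<omega> = Y i \<omega> - expectation (Y i)" for i \<omega>
  have Z1: "integrable M (Z i)" if "i \<in> J" for i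
    using Y1[OF that] by (simp add: Z_def[abs_def])
  have Z0: "expectation (Z i) = 0" if "i \<in> J" for i
    using Y1[OF that] by (simp add: Z_def[abs_def] prob_space)
  have indepZ: "indep_var borel (Z i) borel (Z j)" if "i \<in> J" "j \<in> J" "i \<noteq> j" for i j
    using indep_var_compose[OF indep[OF that], of "\<lambda>x. x - expectation (Y i)" borel
        "\<lambda>x. x - expectation (Y j)" borel]
    by (simp add: comp_def Z_def[abs_def])
  have Z2: "integrable M (\<lambda>\<omega>. Z i \<omega> * Z j \<omega>)" if "i \<in> J" "j \<in> J" for i j
  proof (cases "i = j")
    case True
    then show ?thesis
      using Y1[OF that(1)] Y2[OF that(1)]
      by (simp add: Z_def power2_diff flip: power2_eq_square)
  next
    case False
    then show ?thesis
      using that by (intro indep_var_integrable indepZ Z1)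
  qed
  have E: "expectation (\<lambda>\<omega>. Z i \<omega> * Z j \<omega>) = (if i = j then variance (Y i) else 0)"
    if "i \<in> J" "j \<in> J" for i j
  proof (cases "i = j")
    case True
    then show ?thesis
      by (simp add: Z_def power2_eq_square)
  next
    case False
    then show ?thesis
      using that by (simp add: indep_var_lebesgue_integral[OF indepZ Z1 Z1] Z0)
  qed
  have "variance (\<lambda>\<omega>. \<Sum>i\<in>J. Y i \<omega>) = expectation (\<lambda>\<omega>. \<Sum>i\<in>J. \<Sum>j\<in>J. Z i \<omega> * Z j \<omega>)"
    using Y1 by (simp add: Z_def sum_subtractf power2_eq_square flip: sum_product)
  also have "\<dots> = (\<Sum>i\<in>J. \<Sum>j\<in>J. expectation (\<lambda>\<omega>. Z i \<omega> * Z j \<omega>))"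
    using Z2 by (simp add: Bochner_Integration.integral_sum Bochner_Integration.integrable_sum)
  also have "\<dots> = (\<Sum>i\<in>J. variance (Y i))"
    using fin by (simp add: E sum.delta)
  finally show ?thesis .
qed

section \<open>Riemann sums over equal intervals\<close>

text \<open>The tags stay free within their intervals, so that left endpoints as well as one
  prescribed tag can be used later. The strict \<open>h < d\<close> matters for fineness: a tag may
  be an endpoint, at distance \<open>h\<close> from the other end, while the ball is open.\<close>

lemma uniform_tagged_division:
  fixes a h d :: real and c :: "nat \<Rightarrow> real"
  assumes h: "0 < h" "h < d" and n: "0 < n"
    and c: "\<And>i. i < n \<Longrightarrow> c i \<in> {a + real i * h..a + real (Suc i) * h}"
  defines "p \<equiv> (\<lambda>i. (c i, {a + real i * h..a + real (Suc i) * h})) ` {..<n}"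
  shows "p tagged_division_of {a..a + real n * h}"
    and "(\<lambda>x. ball x d) fine p"
    and "(\<Sum>(x, K)\<in>p. measure lborel K * f x) = (\<Sum>i<n. h * f (c i))"
proof -
  let ?K = "\<lambda>i. {a + real i * h..a + real (Suc i) * h}"
  have ordered: "a + real (Suc i) * h \<le> a + real j * h" if "i < j" for i j
    using that h by (intro add_left_mono mult_right_mono) (auto simp del: of_nat_Suc)
  \<comment> \<open>The induction starts at 1, because for \<open>n = 0\<close> the union is empty
    while the right-hand side is \<open>{a}\<close>.\<close>
  have UN: "(\<Union>i<n. ?K i) = {a..a + real n * h}"
    using n
  proof (induction n rule: nat_induct_non_zero)
    case 1
    show ?case
      by (simp add: lessThan_Suc)
  next
    case (Suc n)
    have "(\<Union>i<Suc n. ?K i) = {a..a + real n * h} \<union> ?K n"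
      using Suc.IH by (simp add: lessThan_Suc Un_commute)
    also have "\<dots> = {a..a + real (Suc n) * h}"
      using h by (intro ivl_disj_un_two_touch) (auto intro!: mult_right_mono)
    finally show ?case .
  qed
  show "p tagged_division_of {a..a + real n * h}"
  proof (rule tagged_division_ofI)
    show "\<Union>{K. \<exists>x. (x, K) \<in> p} = {a..a + real n * h}"
      unfolding UN[symmetric] by (auto simp: p_def)
    fix x K
    assume "(x, K) \<in> p"
    then obtain i where i: "i < n" "x = c i" "K = ?K i"
      by (auto simp: p_def)
    show "x \<in> K" "\<exists>u v. K = cbox u v" 
      using i c by auto
    show "K \<subseteq> {a..a + real n * h}"
      using i(1) unfolding UN[symmetric] i(3) by blast
  next
    fix x1 K1 x2 K2
    assume "(x1, K1) \<in> p" "(x2, K2) \<in> p" "(x1, K1) \<noteq> (x2, K2)"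
    then obtain i j where ij: "K1 = ?K i" "K2 = ?K j" "i \<noteq> j"
      by (auto simp: p_def)
    then consider "i < j" | "j < i"
      by linarith
    then show "interior K1 \<inter> interior K2 = {}"
      using ordered[of i j] ordered[of j i] by cases (auto simp: ij)
  qed (simp add: p_def)
  show "(\<lambda>x. ball x d) fine p"
  proof (rule fineI)
    fix x K
    assume "(x, K) \<in> p"
    then obtain i where i: "i < n" "x = c i" "K = ?K i"
      by (auto simp: p_def)
    show "K \<subseteq> ball x d"
      using c[OF i(1)] h unfolding i by (auto simp: dist_real_def algebra_simps)
  qed
  \<comment> \<open>Distinct indices give distinct intervals whatever the tags, so no term is lost
    in passing from the set \<open>p\<close> to a sum over indices.\<close>
  have "inj_on (\<lambda>i. (c i, ?K i)) {..<n}"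
    using h by (auto intro!: inj_onI simp: Icc_eq_Icc)
  then show "(\<Sum>(x, K)\<in>p. measure lborel K * f x) = (\<Sum>i<n. h * f (c i))"
    unfolding p_def using h by (subst sum.reindex) (auto simp: algebra_simps)
qed

section \<open>Mean-square integrals\<close>

lemma (in prob_space) variance_ms_integral_eq_0:
  fixes Y :: "real \<Rightarrow> 'a \<Rightarrow> real"
  assumes ab: "a < b"
    and nonneg: "\<And>t \<omega>. 0 \<le> Y t \<omega>"
    and indep: "\<And>t s. t \<noteq> s \<Longrightarrow> indep_var borel (Y t) borel (Y s)"
    and ms: "has_ms_integral M Y a b A"
  shows "variance A = 0"
proof -
  define h where "h n = (b - a) / real n" for n :: nat
  define S where "S n c \<omega> = (\<Sum>i<n. h n * Y (c i) \<omega>)" for n :: nat and c :: "nat \<Rightarrow> real" and \<omega>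
  define K where "K n i = {a + real i * h n..a + real (Suc i) * h n}" for n i :: nat
  have h_pos: "0 < h n" if "0 < n" for n
    using ab that by (simp add: h_def)
  have A [measurable]: "A \<in> borel_measurable M" and A2: "integrable M (\<lambda>\<omega>. (A \<omega>)\<^sup>2)"
    using ms by (auto simp: has_ms_integral_def square_integrable_rv_def)
  have A1: "integrable M A"
    by (rule square_integrable_imp_integrable[OF A A2])
  \<comment> \<open>The time \<open>t + 1\<close> is just some time other than \<open>t\<close>:
    independence includes measurability, here also outside \<open>{a..b}\<close>.\<close>
  have Ym [measurable]: "Y t \<in> borel_measurable M" for t
    using indep[of t "t + 1"] by (simp add: indep_var_distribution_eq)
  have Y2: "integrable M (\<lambda>\<omega>. (Y t \<omega>)\<^sup>2)" if "t \<in> {a..b}" for t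
    using ms that by (auto simp: has_ms_integral_def square_integrable_rv_def)
  have Y1: "integrable M (Y t)" if "t \<in> {a..b}" for t
    by (rule square_integrable_imp_integrable[OF Ym Y2[OF that]])
  have K_sub: "K n i \<subseteq> {a..b}" if "i < n" for n i
  proof -
    have "real (Suc i) * h n \<le> real n * h n" "0 \<le> real i * h n"
      using that h_pos[of n] by (auto intro!: mult_right_mono)
    moreover have "real n * h n = b - a"
      using that by (simp add: h_def)
    ultimately show ?thesis
      by (auto simp: K_def)
  qed
  have S2: "integrable M (\<lambda>\<omega>. (S n c \<omega>)\<^sup>2)" if "\<And>i. i < n \<Longrightarrow> c i \<in> K n i" for n c
  proof (rule Bochner_Integration.integrable_bound)
    show "integrable M (\<lambda>\<omega>. real n * (\<Sum>i<n. (h n)\<^sup>2 * (Y (c i) \<omega>)\<^sup>2))"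
      using that K_sub by (intro Bochner_Integration.integrable_mult_right
        Bochner_Integration.integrable_sum Y2) blast
    show "AE \<omega> in M. norm ((S n c \<omega>)\<^sup>2) \<le> norm (real n * (\<Sum>i<n. (h n)\<^sup>2 * (Y (c i) \<omega>)\<^sup>2))"
    proof (rule AE_I2)
      fix \<omega>
      have "(S n c \<omega>)\<^sup>2 \<le> real n * (\<Sum>i<n. (h n)\<^sup>2 * (Y (c i) \<omega>)\<^sup>2)"
        using Cauchy_Schwarz_ineq_sum[of "\<lambda>_. 1" "\<lambda>i. h n * Y (c i) \<omega>" "{..<n}"]
        by (simp add: S_def power_mult_distrib)
      then show "norm ((S n c \<omega>)\<^sup>2) \<le> norm (real n * (\<Sum>i<n. (h n)\<^sup>2 * (Y (c i) \<omega>)\<^sup>2))"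
        by simp
    qed
  qed (simp add: S_def)
  have S_meas [measurable]: "S n c \<in> borel_measurable M" for n c
    unfolding S_def[abs_def] by measurable
  \<comment> \<open>The expectation of a nonintegrable function is 0 by default, so a small value
    carries information only together with this fact.\<close>
  have AS: "integrable M (\<lambda>\<omega>. (A \<omega> - S n c \<omega>)\<^sup>2)" if "\<And>i. i < n \<Longrightarrow> c i \<in> K n i" for n c
  proof (rule Bochner_Integration.integrable_bound)
    show "integrable M (\<lambda>\<omega>. 2 * (A \<omega>)\<^sup>2 + 2 * (S n c \<omega>)\<^sup>2)"
      using A2 S2[OF that] by simp
    show "AE \<omega> in M. norm ((A \<omega> - S n c \<omega>)\<^sup>2) \<le> norm (2 * (A \<omega>)\<^sup>2 + 2 * (S n c \<omega>)\<^sup>2)"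
    proof (rule AE_I2)
      fix \<omega>
      have "(A \<omega> - S n c \<omega>)\<^sup>2 \<le> 2 * (A \<omega>)\<^sup>2 + 2 * (S n c \<omega>)\<^sup>2"
        \<comment> \<open>The two sides differ by exactly this square; the two similar inequalities
          further on are obtained in the same way.\<close>
        using zero_le_power2[of "A \<omega> + S n c \<omega>"] by (simp add: power2_sum power2_diff)
      then show "norm ((A \<omega> - S n c \<omega>)\<^sup>2) \<le> norm (2 * (A \<omega>)\<^sup>2 + 2 * (S n c \<omega>)\<^sup>2)"
        by simp
    qed
  qed simp
  \<comment> \<open>The estimate is uniform in the tags \<open>c\<close>. This lets one fixed
    \<open>n\<close> serve every \<open>t\<close> in the bound \<open>B\<close>.\<close>
  have approx: "\<exists>N. \<forall>n\<ge>N. 0 < n \<and> (\<forall>c. (\<forall>i<n. c i \<in> K n i) \<longrightarrow> expectation (\<lambda>\<omega>. (A \<omega> - S n c \<omega>)\<^sup>2) < e)"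
    if "0 < e" for e
  proof -
    obtain d where d: "0 < d" and lim: "\<And>p. p tagged_division_of {a..b} \<Longrightarrow> (\<lambda>x. ball x d) fine p \<Longrightarrow>
        expectation (\<lambda>\<omega>. (A \<omega> - (\<Sum>(x, K)\<in>p. measure lborel K * Y x \<omega>))\<^sup>2) < e"
      using ms \<open>0 < e\<close> unfolding has_ms_integral_def by meson
    obtain N :: nat where N: "(b - a) / d < real N"
      using reals_Archimedean2 by blast
    have "0 < n \<and> (\<forall>c. (\<forall>i<n. c i \<in> K n i) \<longrightarrow> expectation (\<lambda>\<omega>. (A \<omega> - S n c \<omega>)\<^sup>2) < e)"
      if "N \<le> n" for n
    proof (intro conjI allI impI)
      have "0 < (b - a) / d" "(b - a) / d < real n"
        using ab d N that by auto
      then show n: "0 < n"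
        by (metis of_nat_0_less_iff order_less_trans)
      have hd: "h n < d"
        using \<open>(b - a) / d < real n\<close> n d by (simp add: h_def field_simps)
      have b: "b = a + real n * h n"
        using n by (simp add: h_def)
      fix c
      assume c: "\<forall>i<n. c i \<in> K n i"
      then have c': "\<And>i. i < n \<Longrightarrow> c i \<in> {a + real i * h n..a + real (Suc i) * h n}"
        by (simp add: K_def)
      note division = uniform_tagged_division[OF h_pos[OF n] hd n c']
      have "S n c \<omega> = (\<Sum>(x, L)\<in>(\<lambda>i. (c i, {a + real i * h n..a + real (Suc i) * h n})) ` {..<n}.
          measure lborel L * Y x \<omega>)" for \<omega>
        unfolding S_def by (rule division(3)[symmetric])
      then show "expectation (\<lambda>\<omega>. (A \<omega> - S n c \<omega>)\<^sup>2) < e"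
        using lim[OF division(1)[folded b] division(2)] by simp
    qed
    then show ?thesis
      by blast
  qed
  have tag: "a + real i * h n \<in> K n i" if "i < n" for i n
    using h_pos[of n] that by (simp add: K_def algebra_simps)
  obtain B where B: "\<And>t. t \<in> {a..b} \<Longrightarrow> expectation (\<lambda>\<omega>. (Y t \<omega>)\<^sup>2) \<le> B"
  proof -
    obtain n where n: "0 < n"
      and near: "\<And>c. \<forall>i<n. c i \<in> K n i \<Longrightarrow> expectation (\<lambda>\<omega>. (A \<omega> - S n c \<omega>)\<^sup>2) < 1"
      using approx[of 1] by auto
    \<comment> \<open>The summand 2 is twice the tolerance 1 chosen for the approximation; any fixed
      tolerance would give a bound independent of \<open>t\<close>.\<close>
    have "expectation (\<lambda>\<omega>. (Y t \<omega>)\<^sup>2) \<le> (2 * expectation (\<lambda>\<omega>. (A \<omega>)\<^sup>2) + 2) / (h n)\<^sup>2"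
      if t: "t \<in> {a..b}" for t
    proof -
      have b: "b = a + real n * h n"
        using n by (simp add: h_def)
      have "t \<in> (\<Union>i<n. K n i)"
      proof -
        \<comment> \<open>Only the covering property is wanted here, so \<open>h n + 1\<close>
          stands for an arbitrary mesh bound above \<open>h n\<close>.\<close>
        note div = tagged_division_ofD(6)[OF uniform_tagged_division(1)[of "h n" "h n + 1" n
              "\<lambda>i. a + real i * h n" a]]
        have "t \<in> \<Union>{L. \<exists>x. (x, L) \<in> (\<lambda>i. (a + real i * h n, K n i)) ` {..<n}}"
          using div h_pos[OF n] n t b by (simp add: K_def mult_right_mono)
        then show ?thesis
          by auto
      qed
      then obtain k where k: "k < n" "t \<in> K n k"
        by auto
      \<comment> \<open>Left endpoints, except that the interval containing \<open>t\<close> is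
        tagged by \<open>t\<close>, so that \<open>Y t\<close> occurs in the Riemann sum.\<close>
      define c where "c i = (if i = k then t else a + real i * h n)" for i
      have c: "\<forall>i<n. c i \<in> K n i"
        using k tag by (simp add: c_def)
      have le: "(h n)\<^sup>2 * (Y t \<omega>)\<^sup>2 \<le> 2 * (A \<omega>)\<^sup>2 + 2 * (A \<omega> - S n c \<omega>)\<^sup>2" for \<omega>
      proof -
        have "h n * Y (c k) \<omega> \<le> S n c \<omega>"
          unfolding S_def using k(1) h_pos[OF n] nonneg
          by (intro member_le_sum) (auto intro: mult_nonneg_nonneg less_imp_le)
        then have "h n * Y t \<omega> \<le> S n c \<omega>"
          by (simp add: c_def)
        then have "(h n * Y t \<omega>)\<^sup>2 \<le> (S n c \<omega>)\<^sup>2"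
          using h_pos[OF n] nonneg[of t \<omega>] by (intro power_mono) auto
        also have "\<dots> \<le> 2 * (A \<omega>)\<^sup>2 + 2 * (A \<omega> - S n c \<omega>)\<^sup>2"
          using zero_le_power2[of "2 * A \<omega> - S n c \<omega>"]
          by (simp add: power2_eq_square algebra_simps)
        finally show ?thesis
          by (simp add: power_mult_distrib)
      qed
      have "(h n)\<^sup>2 * expectation (\<lambda>\<omega>. (Y t \<omega>)\<^sup>2) = expectation (\<lambda>\<omega>. (h n)\<^sup>2 * (Y t \<omega>)\<^sup>2)"
        by simp
      also have "\<dots> \<le> expectation (\<lambda>\<omega>. 2 * (A \<omega>)\<^sup>2 + 2 * (A \<omega> - S n c \<omega>)\<^sup>2)"
        using Y2[OF t] A2 AS[of n c] c by (intro integral_mono le) auto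
      also have "\<dots> = 2 * expectation (\<lambda>\<omega>. (A \<omega>)\<^sup>2) + 2 * expectation (\<lambda>\<omega>. (A \<omega> - S n c \<omega>)\<^sup>2)"
        using A2 AS[of n c] c by simp
      also have "\<dots> \<le> 2 * expectation (\<lambda>\<omega>. (A \<omega>)\<^sup>2) + 2"
        using near[OF c] by simp
      finally show ?thesis
        using h_pos[OF n] by (simp add: field_simps)
    qed
    then show ?thesis
      by (rule that)
  qed
  \<comment> \<open>The final estimate is twice the approximation error plus twice the variance of a
    Riemann sum, so each is made smaller than \<open>e / 4\<close>. The shape \<open>0 + e\<close>
    fits \<open>field_le_epsilon\<close>.\<close>
  have "variance A \<le> 0 + e" if e: "0 < e" for e
  proof -
    obtain N where N: "\<And>n. N \<le> n \<Longrightarrow> 0 < n"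
      and near: "\<And>n c. N \<le> n \<Longrightarrow> \<forall>i<n. c i \<in> K n i \<Longrightarrow> expectation (\<lambda>\<omega>. (A \<omega> - S n c \<omega>)\<^sup>2) < e / 4"
      using approx[of "e / 4"] e by auto
    obtain N' :: nat where N': "4 * (b - a)\<^sup>2 * B / e < real N'"
      using reals_Archimedean2 by blast
    define n where "n = max N N'"
    have n: "N \<le> n" "0 < n" "4 * (b - a)\<^sup>2 * B / e < real n"
      using N[of n] N' by (auto simp: n_def)
    \<comment> \<open>Left endpoints are pairwise distinct. Arbitrary tags might coincide at a
      common endpoint of two neighbours, and independence would fail there.\<close>
    define c where "c i = a + real i * h n" for i
    have c: "\<forall>i<n. c i \<in> K n i"
      using tag by (simp add: c_def)
    have cab: "c i \<in> {a..b}" if "i < n" for i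
      using c K_sub that by blast
    have c_neq: "c i \<noteq> c j" if "i \<noteq> j" for i j
      using that h_pos[OF n(2)] by (simp add: c_def)
    have S1: "integrable M (S n c)"
      unfolding S_def[abs_def] using cab Y1 by (intro Bochner_Integration.integrable_sum) auto
    have "variance (S n c) = (\<Sum>i<n. variance (\<lambda>\<omega>. h n * Y (c i) \<omega>))"
      unfolding S_def[abs_def]
    proof (rule variance_sum_pairwise_indep)
      fix i j :: nat
      assume "i \<noteq> j"
      then show "indep_var borel (\<lambda>\<omega>. h n * Y (c i) \<omega>) borel (\<lambda>\<omega>. h n * Y (c j) \<omega>)"
        using indep_var_compose[OF indep[OF c_neq], of i j "\<lambda>x. h n * x" borel "\<lambda>x. h n * x" borel]
        by (simp add: comp_def)
    qed (use cab Y1 Y2 in \<open>auto simp: power_mult_distrib\<close>)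
    also have "\<dots> \<le> (\<Sum>i<n. (h n)\<^sup>2 * B)"
    proof (rule sum_mono)
      fix i
      assume "i \<in> {..<n}"
      then have i: "c i \<in> {a..b}"
        using cab by simp
      have "variance (\<lambda>\<omega>. h n * Y (c i) \<omega>) \<le> expectation (\<lambda>\<omega>. (h n * Y (c i) \<omega> - 0)\<^sup>2)"
        using Y1[OF i] Y2[OF i]
        by (intro variance_le_second_moment_about) (auto simp: power_mult_distrib)
      also have "\<dots> \<le> (h n)\<^sup>2 * B"
        using B[OF i] by (simp add: power_mult_distrib mult_left_mono)
      finally show "variance (\<lambda>\<omega>. h n * Y (c i) \<omega>) \<le> (h n)\<^sup>2 * B" .
    qed
    \<comment> \<open>There are \<open>n\<close> terms, each with the factor \<open>1 / n^2\<close>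
      from the squared mesh; the choice of \<open>N'\<close> makes the result less than
      \<open>e / 4\<close>.\<close>
    also have "\<dots> = (b - a)\<^sup>2 * B / real n"
      using n(2) by (simp add: h_def power2_eq_square)
    also have "\<dots> < e / 4"
      using n e by (simp add: field_simps)
    finally have varS: "variance (S n c) < e / 4" .
    let ?s = "expectation (S n c)"
    have vS: "integrable M (\<lambda>\<omega>. (S n c \<omega> - ?s)\<^sup>2)"
      using S1 S2[of n c] c by (simp add: power2_diff)
    have vA: "integrable M (\<lambda>\<omega>. (A \<omega> - ?s)\<^sup>2)"
      using A1 A2 by (simp add: power2_diff)
    have "variance A \<le> expectation (\<lambda>\<omega>. (A \<omega> - ?s)\<^sup>2)"
      by (rule variance_le_second_moment_about[OF A1 A2])
    also have "\<dots> \<le> expectation (\<lambda>\<omega>. 2 * (A \<omega> - S n c \<omega>)\<^sup>2 + 2 * (S n c \<omega> - ?s)\<^sup>2)"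
    proof (intro integral_mono vA)
      show "integrable M (\<lambda>\<omega>. 2 * (A \<omega> - S n c \<omega>)\<^sup>2 + 2 * (S n c \<omega> - ?s)\<^sup>2)"
        using AS[of n c] vS c by simp
      show "(A \<omega> - ?s)\<^sup>2 \<le> 2 * (A \<omega> - S n c \<omega>)\<^sup>2 + 2 * (S n c \<omega> - ?s)\<^sup>2" for \<omega>
        using zero_le_power2[of "A \<omega> - 2 * S n c \<omega> + ?s"]
        by (simp add: power2_eq_square algebra_simps)
    qed
    also have "\<dots> = 2 * expectation (\<lambda>\<omega>. (A \<omega> - S n c \<omega>)\<^sup>2) + 2 * variance (S n c)"
      using AS[of n c] vS c by simp
    also have "\<dots> \<le> 0 + e"
      using near[OF n(1) c] varS by simp
    finally show ?thesis .
  qed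
  then have "variance A \<le> 0"
    by (rule field_le_epsilon)
  then show ?thesis
    using variance_positive[of A] by linarith
qed

section \<open>Independence from the bivariate density\<close>

text \<open>Without correlation the quadratic form has no mixed term, and both \<open>cosh\<close>
  factors are 1. Positivity of the scales matches the constants, as it turns the root of a squared
  scale into the scale itself.\<close>

lemma biv_BN_density_uncorrelated:
  assumes "0 < \<sigma>1" "0 < \<sigma>2"
  shows "biv_BN_density \<mu>1 \<mu>2 \<sigma>1 \<sigma>2 0 0 (x, y) = BN_density \<mu>1 \<sigma>1 0 x * BN_density \<mu>2 \<sigma>2 0 y"
proof -
  have "sqrt (2 * pi * \<sigma>1\<^sup>2) * sqrt (2 * pi * \<sigma>2\<^sup>2) = (sqrt (2 * pi))\<^sup>2 * (\<sigma>1 * \<sigma>2)"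
    using assms by (simp add: real_sqrt_mult power_mult_distrib power2_eq_square)
  then have "sqrt (2 * pi * \<sigma>1\<^sup>2) * sqrt (2 * pi * \<sigma>2\<^sup>2) = 2 * pi * (\<sigma>1 * \<sigma>2)"
    by simp
  then have const: "1 / (\<sigma>1 * \<sigma>2) * (1 / (2 * pi)) = 1 / (sqrt (2 * pi * \<sigma>1\<^sup>2) * sqrt (2 * pi * \<sigma>2\<^sup>2))"
    by simp
  have exp: "exp (- (1 / 2) * (u + v)) = exp (- (1 / 2) * u) * exp (- (1 / 2) * v)" for u v :: real
    by (simp add: exp_add[symmetric] algebra_simps)
  define u v where "u = (x - \<mu>1) / \<sigma>1" and "v = (y - \<mu>2) / \<sigma>2"
  have "biv_BN_density \<mu>1 \<mu>2 \<sigma>1 \<sigma>2 0 0 (x, y)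
      = 1 / (\<sigma>1 * \<sigma>2) * (1 / (2 * pi)) * exp (- (1 / 2) * (u\<^sup>2 + v\<^sup>2))"
    by (simp add: biv_BN_density_def std_binormal_density_def u_def v_def)
  also have "\<dots> = BN_density \<mu>1 \<sigma>1 0 x * BN_density \<mu>2 \<sigma>2 0 y"
    unfolding const exp by (simp add: BN_density_def u_def v_def)
  finally show ?thesis .
qed

lemma (in prob_space) indep_var_if_biv_BN_pairs_uncorrelated:
  assumes BN: "BN_process M X \<mu> \<sigma> 0" and biv: "biv_BN_pairs M X \<mu> \<sigma> 0 0" and "t \<noteq> s"
  shows "indep_var borel (X t) borel (X s)"
proof -
  let ?f = "\<lambda>t x. ennreal (BN_density (\<mu> t) (\<sigma> t) 0 x)"
  have pos: "0 < \<sigma> t" and D: "distributed M lborel (X t) (?f t)" for t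
    using BN by (auto simp: BN_process_def)
  have [measurable]: "random_variable borel (X t)" for t
    using distributed_measurable[OF D, of t] by simp
  have f [measurable]: "?f t \<in> borel_measurable lborel" for t
    using distributed_borel_measurable[OF D, of t] by simp
  have nonneg: "0 \<le> BN_density \<mu> \<sigma> 0 x" for \<mu> \<sigma> x
    by (simp add: BN_density_def)
  have biv_eq: "ennreal (biv_BN_density (\<mu> t) (\<mu> s) (\<sigma> t) (\<sigma> s) 0 0 z) = ?f t (fst z) * ?f s (snd z)" for z
    by (cases z) (simp only: biv_BN_density_uncorrelated[OF pos pos] ennreal_mult'[OF nonneg] fst_conv snd_conv)
  \<comment> \<open>This provides the sigma-finiteness of the second factor that
    \<open>pair_measure_density\<close> demands.\<close>
  interpret Xs: prob_space "density lborel (?f s)"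
    unfolding distributed_distr_eq_density[OF D, symmetric]
    by (rule prob_space_distr) simp
  have "distr M (lborel \<Otimes>\<^sub>M lborel) (\<lambda>\<omega>. (X t \<omega>, X s \<omega>))
      = density (lborel \<Otimes>\<^sub>M lborel) (\<lambda>z. ennreal (biv_BN_density (\<mu> t) (\<mu> s) (\<sigma> t) (\<sigma> s) 0 0 z))"
    using biv \<open>t \<noteq> s\<close> by (intro distributed_distr_eq_density) (auto simp: biv_BN_pairs_def)
  also have "\<dots> = density (lborel \<Otimes>\<^sub>M lborel) (\<lambda>(x, y). ?f t x * ?f s y)"
    by (simp only: biv_eq case_prod_beta')
  also have "\<dots> = density lborel (?f t) \<Otimes>\<^sub>M density lborel (?f s)"
    by (intro pair_measure_density[symmetric] f lborel.sigma_finite_measure_axioms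
        Xs.sigma_finite_measure_axioms)
  also have "\<dots> = distr M lborel (X t) \<Otimes>\<^sub>M distr M lborel (X s)"
    by (simp add: distributed_distr_eq_density[OF D])
  finally have "indep_var lborel (X t) lborel (X s)"
    by (simp add: indep_var_distribution_eq)
  then show ?thesis
    by (simp add: indep_var_eq)
qed

section \<open>Variance ergodicity\<close>

theorem proposition8p10:
  fixes M :: "'a measure"
    and X :: "real \<Rightarrow> 'a \<Rightarrow> real"
    and \<mu> \<sigma> :: "real \<Rightarrow> real"
    and \<alpha> \<rho> m :: real
    and I :: "real \<Rightarrow> 'a \<Rightarrow> real"
  assumes "prob_space M"
    and "BN_process M X \<mu> \<sigma> \<alpha>"
    and "\<rho> \<in> {-1<..<1}"
    and "biv_BN_pairs M X \<mu> \<sigma> \<alpha> \<rho>"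
    and "\<And>t. \<mu> t = m"
    and "\<rho> = 0" and "\<alpha> = 0"
    and integral_makes_sense:
      "\<And>T. T > 0 \<Longrightarrow>
         has_path_integral M (\<lambda>t \<omega>. (X t \<omega> - m)\<^sup>2) (- T) T (I T) \<or>
         has_ms_integral M (\<lambda>t \<omega>. (X t \<omega> - m)\<^sup>2) (- T) T (I T)"
    and "((\<lambda>T. 1 / (4 * T\<^sup>2) *
            (LBINT t:{- T..T}. LBINT t':{- T..T}.
               covariance M (\<lambda>\<omega>. (X t \<omega>)\<^sup>2) (\<lambda>\<omega>. (X t' \<omega>)\<^sup>2))) \<longlongrightarrow> 0) at_top"
    and "((\<lambda>T. 1 / (4 * T\<^sup>2) *
            (LBINT t:{- T..T}. LBINT t':{- T..T}.
               covariance M (\<lambda>\<omega>. (X t \<omega>)\<^sup>2) (X t'))) \<longlongrightarrow> 0) at_top"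
  shows "((\<lambda>T. prob_space.variance M (\<lambda>\<omega>. 1 / (2 * T) * I T \<omega>)) \<longlongrightarrow> 0) at_top"
proof -
  interpret prob_space M
    by fact
  have indepX: "indep_var borel (X t) borel (X s)" if "t \<noteq> s" for t s
    using assms(2,4,6,7) that by (auto intro: indep_var_if_biv_BN_pairs_uncorrelated)
  have indep: "indep_var borel (\<lambda>\<omega>. (X t \<omega> - m)\<^sup>2) borel (\<lambda>\<omega>. (X s \<omega> - m)\<^sup>2)" if "t \<noteq> s" for t s
    using indep_var_compose[OF indepX[OF that], of "\<lambda>x. (x - m)\<^sup>2" borel "\<lambda>x. (x - m)\<^sup>2" borel]
    by (simp add: comp_def)
  \<comment> \<open>The variance vanishes at every positive \<open>T\<close>, so the limit is that
    of an eventually constant function.\<close>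
  have "variance (\<lambda>\<omega>. 1 / (2 * T) * I T \<omega>) = 0" if "0 < T" for T
  proof -
    have "variance (I T) = 0"
      using integral_makes_sense[OF that]
    proof
      assume "has_path_integral M (\<lambda>t \<omega>. (X t \<omega> - m)\<^sup>2) (- T) T (I T)"
      then show ?thesis
        by (rule variance_path_integral_eq_0[rotated -1]) (auto intro: indep)
    next
      assume "has_ms_integral M (\<lambda>t \<omega>. (X t \<omega> - m)\<^sup>2) (- T) T (I T)"
      then show ?thesis
        by (rule variance_ms_integral_eq_0[rotated -1]) (use that in \<open>auto intro: indep\<close>)
    qed
    moreover have "variance (\<lambda>\<omega>. 1 / (2 * T) * I T \<omega>) = (1 / (2 * T))\<^sup>2 * variance (I T)"
    proof -
      have "variance (\<lambda>\<omega>. 1 / (2 * T) * I T \<omega>)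
          = expectation (\<lambda>\<omega>. (1 / (2 * T))\<^sup>2 * (I T \<omega> - expectation (I T))\<^sup>2)"
        \<comment> \<open>\<open>integral_mult_right_zero\<close> pulls out the constant without an
          integrability condition, so both senses of the integral are treated alike.\<close>
        by (simp only: integral_mult_right_zero right_diff_distrib[symmetric] power_mult_distrib)
      then show ?thesis
        by simp
    qed
    ultimately show ?thesis
      by simp
  qed
  then have "\<forall>\<^sub>F T in at_top. variance (\<lambda>\<omega>. 1 / (2 * T) * I T \<omega>) = 0"
    by (rule eventually_mono[OF eventually_gt_at_top[of 0]])
  then show ?thesis
    by (rule tendsto_eventually)
qed

end
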